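(* Let $J,R,Q\in\mathbb{R}^{n\times n}$ with $J$ skew-symmetric, $R$ symmetric positive semidefinite, $Q$ symmetric positive definite, let $B\in\mathbb{R}^{n\times m}$ have full rank $m\le n$, and set $A=(J-R)Q$. Let $\mathbb{U}=[\underline{u}_1,\overline{u}_1]\times\dots\times[\underline{u}_m,\overline{u}_m]\subset\mathbb{R}^m$ be compact with $0\in\operatorname{int}(\mathbb{U})$. Assume that $\operatorname{rank}(B,AB,\ldots,A^{n-1}B)=n$. Let $\mathbb{R}^n=M_1\oplus_Q M_2$ be the decomposition into conservative and dissipative subspaces (see context), and let $x^0\in\mathbb{R}^n$. Then there is a compact set $K\subset M_2$ such that all states reachable from $x^0$ (in arbitrary time $T\ge0$, with controls $u\in L^1(0,T;\mathbb{U})$) under $\dot x=(J-R)Qx+Bu$, $x(0)=x^0$, are contained in $M_1\oplus_Q K=\{v+k: v\in M_1,\ k\in K\}$.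
   Context: $L^1(0,T;\mathbb{U})$ is the set of Lebesgue-measurable, integrable functions on $(0,T)$ with values in $\mathbb{U}$; differential equations hold almost everywhere with absolutely continuous solutions. Decomposition: for $\lambda\in\mathbb{C}$ let $N_\lambda(A)=\operatorname{span}\{\operatorname{Re}(x),\operatorname{Im}(x):x\in\ker(A-\lambda I_n)\}\subset\mathbb{R}^n$ (kernel in $\mathbb{C}^n$). Set $M_1=\operatorname{span}\{N_{i\alpha}(A): \alpha\in\mathbb{R},\ i\alpha\in\sigma(A)\}$ and let $M_2$ be the orthogonal complement of $M_1$ with respect to the inner product $\langle Q\,\cdot,\cdot\rangle$; $\oplus_Q$ denotes the direct sum orthogonal with respect to this inner product. Both subspaces are invariant under $JQ$ and $RQ$, $RQ$ vanishes on $M_1$, and the restriction of $(J-R)Q$ to $M_2$ is Hurwitz (all eigenvalues have negative real part). *)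

theory Defs
  imports "HOL-Analysis.Analysis"
begin

definition pos_semidef :: "real^'n^'n \<Rightarrow> bool" where
  "pos_semidef M \<longleftrightarrow> (\<forall>x. 0 \<le> (M *v x) \<bullet> x)"

definition pos_def :: "real^'n^'n \<Rightarrow> bool" where
  "pos_def M \<longleftrightarrow> (\<forall>x. x \<noteq> 0 \<longrightarrow> 0 < (M *v x) \<bullet> x)"

(* The class operations on vectors are componentwise, so M ^ k would not be a matrix power. *)
primrec matrix_power :: "'a::semiring_1^'n^'n \<Rightarrow> nat \<Rightarrow> 'a^'n^'n" where
  "matrix_power M 0 = mat 1"
| "matrix_power M (Suc k) = M ** matrix_power M k"

(* The block matrix (B, AB, ..., A^(n-1) B). Its columns are indexed by pairs (p, j) of a block p
   and a column j of B; the blocks are numbered 0, ..., n-1 by an arbitrary enumeration of 'n,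
   so the matrix is determined up to a permutation of its blocks. *)
definition kalman_matrix :: "real^'n^'n \<Rightarrow> real^'m^'n \<Rightarrow> real^('n \<times> 'm)^'n" where
  "kalman_matrix A B =
     (\<chi> i pj. (matrix_power A (to_nat_on UNIV (fst pj)) ** B) $ i $ snd pj)"

lemma columns_kalman_matrix:
  fixes A :: "real^'n^'n" and B :: "real^'m^'n"
  shows "columns (kalman_matrix A B) = (\<Union>k<CARD('n). columns (matrix_power A k ** B))"
proof -
  have col: "column (p, j) (kalman_matrix A B)
      = column j (matrix_power A (to_nat_on UNIV p) ** B)" for p j
    by (simp add: column_def kalman_matrix_def)
  have "bij_betw (to_nat_on (UNIV :: 'n set)) UNIV {..<CARD('n)}"
    by (rule to_nat_on_finite) simp
  then have "{..<CARD('n)} = range (to_nat_on (UNIV :: 'n set))"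
    by (simp add: bij_betw_def)
  then show ?thesis
    by (auto simp: columns_def col)
qed

definition matrix_kernel :: "'a::comm_ring_1^'n^'m \<Rightarrow> ('a^'n) set" where
  "matrix_kernel M = {z. M *v z = 0}"

definition spectrum :: "real^'n^'n \<Rightarrow> complex set" where
  "spectrum A = {\<mu>. \<exists>z. z \<noteq> 0 \<and> map_matrix complex_of_real A *v z = \<mu> *s z}"

definition Re_vec :: "complex^'n \<Rightarrow> real^'n" where
  "Re_vec z = (\<chi> i. Re (z $ i))"

definition Im_vec :: "complex^'n \<Rightarrow> real^'n" where
  "Im_vec z = (\<chi> i. Im (z $ i))"

definition real_eigenspace :: "real^'n^'n \<Rightarrow> complex \<Rightarrow> (real^'n) set" where
  "real_eigenspace A \<mu> =
     span (\<Union>z \<in> matrix_kernel (map_matrix complex_of_real A - mat \<mu>). {Re_vec z, Im_vec z})"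

definition conservative_subspace :: "real^'n^'n \<Rightarrow> (real^'n) set" where
  "conservative_subspace A =
     span (\<Union>\<alpha> \<in> {\<alpha>::real. \<i> * complex_of_real \<alpha> \<in> spectrum A}.
             real_eigenspace A (\<i> * complex_of_real \<alpha>))"

definition dissipative_subspace :: "real^'n^'n \<Rightarrow> real^'n^'n \<Rightarrow> (real^'n) set" where
  "dissipative_subspace Q A = {x. \<forall>y \<in> conservative_subspace A. (Q *v x) \<bullet> y = 0}"

(* The epsilon-delta definition: the members of D are finitely many compact intervals
   [Inf k, Sup k] with pairwise disjoint interiors. *)
definition abs_continuous_on :: "real set \<Rightarrow> (real \<Rightarrow> 'a::metric_space) \<Rightarrow> bool" where
  "abs_continuous_on I f \<longleftrightarrow>
     (\<forall>\<epsilon>>0. \<exists>\<delta>>0. \<forall>D S. D division_of S \<and> S \<subseteq> I \<and> (\<Sum>k\<in>D. measure lborel k) < \<delta> \<longrightarrow>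
        (\<Sum>k\<in>D. dist (f (Sup k)) (f (Inf k))) < \<epsilon>)"

definition admissible_controls :: "real \<Rightarrow> (real^'m) set \<Rightarrow> (real \<Rightarrow> real^'m) set" where
  "admissible_controls T U =
     {u. u absolutely_integrable_on {0<..<T} \<and> (\<forall>t \<in> {0<..<T}. u t \<in> U)}"

definition is_solution ::
  "real^'n^'n \<Rightarrow> real^'m^'n \<Rightarrow> real \<Rightarrow> real^'n \<Rightarrow> (real \<Rightarrow> real^'m) \<Rightarrow> (real \<Rightarrow> real^'n) \<Rightarrow> bool" where
  "is_solution A B T x0 u x \<longleftrightarrow>
     abs_continuous_on {0..T} x \<and> x 0 = x0 \<and>
     (AE t \<in> {0<..<T} in lebesgue. (x has_vector_derivative (A *v x t + B *v u t)) (at t))"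

definition reachable_set ::
  "real^'n^'n \<Rightarrow> real^'m^'n \<Rightarrow> (real^'m) set \<Rightarrow> real^'n \<Rightarrow> (real^'n) set" where
  "reachable_set A B U x0 =
     {x T | T u x. 0 \<le> T \<and> u \<in> admissible_controls T U \<and> is_solution A B T x0 u x}"

end

theory Submission
  imports Defs
begin

text \<open>
  Write \<open>\<langle>x, y\<rangle> = Q x \<bullet> y\<close>. Then \<open>\<langle>A x, x\<rangle> = - R Q x \<bullet> Q x \<le> 0\<close>, which forces \<open>R Q\<close> to vanish
  on \<open>M\<^sub>1\<close>, so \<open>A\<close> is skew there and \<open>M\<^sub>2\<close> is invariant. Conversely, if \<open>\<langle>A x, x\<rangle>\<close> vanishes on a
  nonzero invariant subspace \<open>N\<close>, then \<open>A\<close> is skew on \<open>N\<close>, and a unit vector of \<open>N\<close> maximising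
  \<open>\<langle>A v, A v\<rangle>\<close> satisfies \<open>A\<^sup>2 v = - \<alpha>\<^sup>2 v\<close>; it is the real part of an eigenvector for an imaginary
  eigenvalue up to scaling, hence \<open>v \<in> M\<^sub>1\<close>. So \<open>M\<^sub>2\<close> contains no such \<open>N\<close>.

  Since \<open>A\<close> commutes with its powers, \<open>w(x, y) = (\<Sum>k\<le>n. \<langle>A\<^sup>k x, A\<^sup>k y\<rangle>)\<close> satisfies
  \<open>w(A x, x) = (\<Sum>k\<le>n. \<langle>A A\<^sup>k x, A\<^sup>k x\<rangle>) \<le> 0\<close>, and a compactness argument gives an \<open>n\<close> for which this
  is negative definite on \<open>M\<^sub>2\<close>. Along a solution, the \<open>M\<^sub>2\<close>-component \<open>y\<close> obeys \<open>y' = A y + P B u\<close>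
  with a bounded input, so the absolutely continuous function \<open>w(y, y)\<close> has nonpositive derivative
  wherever it is large, and therefore stays bounded.
\<close>

section \<open>Absolutely continuous functions\<close>

lemma abs_continuous_on_subset:
  assumes "abs_continuous_on I f" "I' \<subseteq> I"
  shows "abs_continuous_on I' f"
  using assms unfolding abs_continuous_on_def by (meson order_trans)

text \<open>Only the image of \<open>f\<close> carries the Lipschitz condition, because the intended
  \<open>g\<close> is a quadratic form, which is Lipschitz merely on bounded sets.\<close>

lemma abs_continuous_on_Lipschitz_compose:
  fixes f :: "real \<Rightarrow> 'a::metric_space" and g :: "'a \<Rightarrow> 'b::metric_space"
  assumes f: "abs_continuous_on I f" and g: "L-lipschitz_on (f ` I) g"
  shows "abs_continuous_on I (\<lambda>t. g (f t))"
  unfolding abs_continuous_on_def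
proof (intro allI impI)
  fix \<epsilon> :: real assume "\<epsilon> > 0"
  have L: "0 \<le> L" using g by (rule lipschitz_on_nonneg)
  \<comment> \<open>The summand 1 keeps the quotient meaningful when \<open>L = 0\<close>.\<close>
  then have "\<epsilon> / (L + 1) > 0" using \<open>\<epsilon> > 0\<close> by simp
  then obtain \<delta> where "\<delta> > 0" and \<delta>: "\<And>D S. D division_of S \<Longrightarrow> S \<subseteq> I \<Longrightarrow>
      (\<Sum>k\<in>D. measure lborel k) < \<delta> \<Longrightarrow> (\<Sum>k\<in>D. dist (f (Sup k)) (f (Inf k))) < \<epsilon> / (L + 1)"
    using f unfolding abs_continuous_on_def by meson
  have "(\<Sum>k\<in>D. dist (g (f (Sup k))) (g (f (Inf k)))) < \<epsilon>"
    if D: "D division_of S" "S \<subseteq> I" "(\<Sum>k\<in>D. measure lborel k) < \<delta>" for D S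
  proof -
    have *: "Sup k \<in> I \<and> Inf k \<in> I" if k: "k \<in> D" for k
    proof -
      obtain a b where ab: "k = cbox a b" "k \<noteq> {}" "k \<subseteq> S"
        using division_ofD[OF D(1)] k by metis
      then have "a \<le> b" by auto
      then show ?thesis using ab D(2) by auto
    qed
    have "(\<Sum>k\<in>D. dist (g (f (Sup k))) (g (f (Inf k)))) \<le> (\<Sum>k\<in>D. L * dist (f (Sup k)) (f (Inf k)))"
      using * by (intro sum_mono lipschitz_onD[OF g]) auto
    also have "\<dots> = L * (\<Sum>k\<in>D. dist (f (Sup k)) (f (Inf k)))"
      by (simp add: sum_distrib_left)
    also have "\<dots> \<le> L * (\<epsilon> / (L + 1))"
      using \<delta>[OF D] L by (intro mult_left_mono) auto
    also have "\<dots> < \<epsilon>" using L \<open>\<epsilon> > 0\<close> by (simp add: field_simps)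
    finally show ?thesis .
  qed
  then show "\<exists>\<delta>>0. \<forall>D S. D division_of S \<and> S \<subseteq> I \<and> (\<Sum>k\<in>D. measure lborel k) < \<delta> \<longrightarrow>
        (\<Sum>k\<in>D. dist (g (f (Sup k))) (g (f (Inf k)))) < \<epsilon>"
    using \<open>\<delta> > 0\<close> by blast
qed

lemma abs_continuous_on_imp_continuous_on:
  fixes f :: "real \<Rightarrow> 'a::metric_space"
  assumes "abs_continuous_on {a..b} f"
  shows "continuous_on {a..b} f"
  unfolding continuous_on_iff
proof (intro ballI allI impI)
  fix s and \<epsilon> :: real assume s: "s \<in> {a..b}" and "\<epsilon> > 0"
  then obtain \<delta> where "\<delta> > 0" and \<delta>: "\<And>D S. D division_of S \<Longrightarrow> S \<subseteq> {a..b} \<Longrightarrow>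
      (\<Sum>k\<in>D. measure lborel k) < \<delta> \<Longrightarrow> (\<Sum>k\<in>D. dist (f (Sup k)) (f (Inf k))) < \<epsilon>"
    using assms unfolding abs_continuous_on_def by meson
  have close: "dist (f v) (f u) < \<epsilon>" if "u \<le> v" "v - u < \<delta>" "u \<in> {a..b}" "v \<in> {a..b}" for u v
  proof -
    have "{{u..v}} division_of {u..v}"
      using division_of_self[of u v] that by simp
    from \<delta>[OF this] show ?thesis using that by auto
  qed
  have "dist (f t) (f s) < \<epsilon>" if "t \<in> {a..b}" "dist t s < \<delta>" for t
    using close[of s t] close[of t s] that s by (cases "s \<le> t") (auto simp: dist_commute dist_real_def)
  then show "\<exists>d>0. \<forall>x'\<in>{a..b}. dist x' s < d \<longrightarrow> dist (f x') (f s) < \<epsilon>"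
    using \<open>\<delta> > 0\<close> by blast
qed

section \<open>Monotonicity from the sign of the derivative almost everywhere\<close>

lemma null_set_outer_open:
  fixes N :: "'a::euclidean_space set"
  assumes "N \<in> null_sets lebesgue" and "e > 0"
  obtains V where "open V" "N \<subseteq> V" "V \<in> lmeasurable" "measure lebesgue V < e"
proof -
  have "N \<in> sets lebesgue" using assms(1) by auto
  then obtain V where V: "open V" "N \<subseteq> V" "V - N \<in> lmeasurable" "emeasure lebesgue (V - N) < ennreal e"
    using sets_lebesgue_outer_open \<open>e > 0\<close> by blast
  have "V = (V - N) \<union> N" using V(2) by auto
  then have lm: "V \<in> lmeasurable"
    using V(3) fmeasurableI_null_sets[OF assms(1)] fmeasurable.Un by metis
  have "measure lebesgue V = measure lebesgue (V - N)"
    using assms(1) V(1) by (simp add: measure_Diff_null_set borel_open)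
  also have "\<dots> < e"
    using V(3,4) by (metis emeasure_eq_measure2 ennreal_leI linorder_not_le)
  finally show thesis using that V lm by blast
qed

text \<open>A gauge separates the two reasons for a small increment. Intervals tagged in the
  exceptional null set lie in an open set of measure below \<open>\<delta>\<close>, so absolute
  continuity bounds their total increment by \<open>\<epsilon>\<close>. On every other interval the
  derivative at the tag bounds the increment by \<open>\<epsilon>\<close> times the length.\<close>

lemma abs_continuous_nonincreasing:
  fixes f :: "real \<Rightarrow> real"
  assumes "a \<le> b" and ac: "abs_continuous_on {a..b} f"
    and der: "AE t \<in> {a<..<b} in lebesgue. \<exists>D\<le>0. (f has_real_derivative D) (at t)"
  shows "f b \<le> f a"
proof -
  obtain N0 where N0: "N0 \<in> null_sets lebesgue"
    and N0d: "{t \<in> space lebesgue. \<not> (t \<in> {a<..<b} \<longrightarrow> (\<exists>D\<le>0. (f has_real_derivative D) (at t)))} \<subseteq> N0"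
    using der by (auto simp: eventually_ae_filter)
  \<comment> \<open>The endpoints join the exceptional set because \<open>der\<close> speaks of the
    open interval only.\<close>
  define N where "N = N0 \<union> {a, b}"
  have "{a, b} \<in> null_sets lebesgue"
    by (simp flip: negligible_iff_null_sets)
  then have N: "N \<in> null_sets lebesgue"
    unfolding N_def using N0 by (intro null_sets.Un)
  have good: "\<exists>D\<le>0. (f has_real_derivative D) (at t)" if "t \<in> {a..b}" "t \<notin> N" for t
    using that N0d unfolding N_def by force
  have main: "f b - f a \<le> \<epsilon> * (b - a + 1)" if "\<epsilon> > 0" for \<epsilon>
  proof -
    obtain \<delta> where "\<delta> > 0" and \<delta>: "\<And>D S. D division_of S \<Longrightarrow> S \<subseteq> {a..b} \<Longrightarrow>
      (\<Sum>k\<in>D. measure lborel k) < \<delta> \<Longrightarrow> (\<Sum>k\<in>D. dist (f (Sup k)) (f (Inf k))) < \<epsilon>"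
      using ac \<open>\<epsilon> > 0\<close> unfolding abs_continuous_on_def by meson
    obtain V where V: "open V" "N \<subseteq> V" "V \<in> lmeasurable" "measure lebesgue V < \<delta>"
      using null_set_outer_open[OF N \<open>\<delta> > 0\<close>] by blast
    \<comment> \<open>Straddle estimate: for \<open>u \<le> t \<le> v\<close> the linearisation
      errors at \<open>u\<close> and \<open>v\<close> add up to at most
      \<open>\<epsilon> * (v - u)\<close>, and the linear part is nonpositive since
      \<open>D \<le> 0\<close>.\<close>
    have "\<exists>d>0. \<forall>u v. u \<le> t \<and> t \<le> v \<and> u \<in> ball t d \<and> v \<in> ball t d \<longrightarrow> f v - f u \<le> \<epsilon> * (v - u)"
      if t: "t \<in> {a..b}" "t \<notin> N" for t
    proof -
      obtain D where D: "D \<le> 0" "(f has_derivative (\<lambda>h. h * D)) (at t)"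
        using good[OF t] by (auto simp: has_field_derivative_def mult.commute)
      obtain d where "d > 0" and d: "\<And>y. norm (y - t) < d \<Longrightarrow>
          norm (f y - f t - (y - t) * D) \<le> \<epsilon> * norm (y - t)"
        using D(2) \<open>\<epsilon> > 0\<close> unfolding has_derivative_within_alt by force
      have "f v - f u \<le> \<epsilon> * (v - u)" if "u \<le> t" "t \<le> v" "u \<in> ball t d" "v \<in> ball t d" for u v
      proof -
        have "norm (f u - f t - (u - t) * D) \<le> \<epsilon> * (t - u)"
          using d[of u] that by (auto simp: dist_real_def)
        moreover have "norm (f v - f t - (v - t) * D) \<le> \<epsilon> * (v - t)"
          using d[of v] that by (auto simp: dist_real_def)
        moreover have "(v - t) * D \<le> 0" "0 \<le> (u - t) * D"
          using that D(1) by (auto simp: mult_nonneg_nonpos mult_nonpos_nonpos)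
        moreover have "\<epsilon> * (v - u) = \<epsilon> * (v - t) + \<epsilon> * (t - u)" by (simp add: algebra_simps)
        ultimately show ?thesis unfolding real_norm_def abs_le_iff by linarith
      qed
      then show ?thesis using \<open>d > 0\<close> by blast
    qed
    then obtain d where d: "\<And>t. t \<in> {a..b} \<Longrightarrow> t \<notin> N \<Longrightarrow> d t > 0 \<and>
        (\<forall>u v. u \<le> t \<and> t \<le> v \<and> u \<in> ball t (d t) \<and> v \<in> ball t (d t) \<longrightarrow> f v - f u \<le> \<epsilon> * (v - u))"
      by metis
    \<comment> \<open>Tags of a division of \<open>{a..b}\<close> never meet the third case; it only
      makes \<open>\<gamma>\<close> a gauge on the whole line.\<close>
    define \<gamma> where "\<gamma> t = (if t \<in> N then V else if t \<in> {a..b} then ball t (d t) else ball t 1)" for t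
    have "gauge \<gamma>" unfolding gauge_def \<gamma>_def using V d by auto
    then obtain p where p: "p tagged_division_of {a..b}" "\<gamma> fine p"
      using fine_division_exists_real by blast
    have finp: "finite p" using p(1) by (rule tagged_division_of_finite)
    define q where "q = {z \<in> p. fst z \<in> N}"
    have pk: "\<exists>u v. k = {u..v} \<and> u \<le> t \<and> t \<le> v \<and> Sup k = v \<and> Inf k = u \<and> t \<in> {a..b} \<and> k \<subseteq> \<gamma> t"
      if tk: "(t, k) \<in> p" for t k
    proof -
      obtain u v where uv: "k = {u..v}" "t \<in> k" "k \<subseteq> {a..b}"
        using tagged_division_ofD(2,3,4)[OF p(1) tk] by auto
      moreover have "k \<subseteq> \<gamma> t" using p(2) tk by (rule fineD)
      ultimately show ?thesis by auto
    qed
    have qp: "q tagged_partial_division_of {a..b}"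
      by (rule tagged_partial_division_subset[of p]) (use p(1) in \<open>auto simp: tagged_division_of_def q_def\<close>)
    let ?S = "\<Union>(snd ` q)"
    have qd: "(snd ` q) division_of ?S" using partial_division_of_tagged_division[OF qp] .
    have qt: "q tagged_division_of ?S" using tagged_partial_division_of_Union_self[OF qp] .
    have SV: "?S \<subseteq> V"
    proof -
      have "k \<subseteq> V" if "(t, k) \<in> q" for t k
        using pk[of t k] that by (auto simp: q_def \<gamma>_def)
      then show ?thesis by fastforce
    qed
    have Sab: "?S \<subseteq> {a..b}"
      using tagged_partial_division_ofD(3)[OF qp] by fastforce
    have "(\<Sum>k\<in>snd ` q. measure lborel k) = (\<Sum>k\<in>snd ` q. measure lebesgue k)"
    proof (intro sum.cong refl)
      fix k assume "k \<in> snd ` q"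
      then obtain u v where "k = cbox u v" using division_ofD(4)[OF qd] by blast
      then show "measure lborel k = measure lebesgue k" by simp
    qed
    also have "\<dots> = measure lebesgue ?S" using content_division[OF qd] by simp
    also have "\<dots> \<le> measure lebesgue V"
      using SV V(3) lmeasurable_division[OF qd] by (intro measure_mono_fmeasurable) auto
    also have "\<dots> < \<delta>" using V by simp
    finally have "(\<Sum>k\<in>snd ` q. dist (f (Sup k)) (f (Inf k))) < \<epsilon>"
      using \<delta>[OF qd Sab] by simp
    moreover have "(\<Sum>(t,k)\<in>q. dist (f (Sup k)) (f (Inf k))) = (\<Sum>k\<in>snd ` q. dist (f (Sup k)) (f (Inf k)))"
    proof -
      \<comment> \<open>the library lemma also asks about empty intervals, where \<open>Sup\<close> and \<open>Inf\<close> have junk values\<close>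
      define e where "e k = (if k = {} then 0 else dist (f (Sup k)) (f (Inf k)))" for k
      have "e (cbox u v) = 0" if "box u v = {}" for u v
        using that by (cases "u = v") (auto simp: e_def)
      then have "(\<Sum>(t,k)\<in>q. e k) = (\<Sum>k\<in>snd ` q. e k)"
        by (rule sum.over_tagged_division_lemma[OF qt])
      moreover have "k \<noteq> {}" if "(t, k) \<in> q" for t k
        using tagged_partial_division_ofD(2)[OF qp that] by blast
      then have "(\<Sum>(t,k)\<in>q. e k) = (\<Sum>(t,k)\<in>q. dist (f (Sup k)) (f (Inf k)))"
        "(\<Sum>k\<in>snd ` q. e k) = (\<Sum>k\<in>snd ` q. dist (f (Sup k)) (f (Inf k)))"
        by (auto simp: e_def intro!: sum.cong)
      ultimately show ?thesis by simp
    qed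
    moreover have "(\<Sum>(t,k)\<in>q. f (Sup k) - f (Inf k)) \<le> (\<Sum>(t,k)\<in>q. dist (f (Sup k)) (f (Inf k)))"
      by (intro sum_mono) (auto simp: dist_real_def)
    ultimately have bad: "(\<Sum>(t,k)\<in>q. f (Sup k) - f (Inf k)) \<le> \<epsilon>" by linarith
    have "(\<Sum>(t,k)\<in>p - q. f (Sup k) - f (Inf k)) \<le> (\<Sum>(t,k)\<in>p - q. \<epsilon> * (Sup k - Inf k))"
    proof (intro sum_mono, clarify)
      fix t k assume tk: "(t, k) \<in> p" "(t, k) \<notin> q"
      then obtain u v where uv: "k = {u..v}" "u \<le> t" "t \<le> v" "Sup k = v" "Inf k = u" "t \<in> {a..b}" "k \<subseteq> \<gamma> t"
        using pk by blast
      moreover have "t \<notin> N" using tk by (auto simp: q_def)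
      moreover have "k \<subseteq> ball t (d t)" using uv \<open>t \<notin> N\<close> by (simp add: \<gamma>_def)
      then have "u \<in> ball t (d t)" "v \<in> ball t (d t)" using uv(1,2,3) by (force simp del: mem_ball)+
      ultimately show "f (Sup k) - f (Inf k) \<le> \<epsilon> * (Sup k - Inf k)"
        using d[of t] by (simp del: mem_ball)
    qed
    \<comment> \<open>Restoring the intervals of \<open>q\<close> adds nonnegative terms, and the
      sum over the full division telescopes.\<close>
    also have "\<dots> \<le> (\<Sum>(t,k)\<in>p. \<epsilon> * (Sup k - Inf k))"
    proof (rule sum_mono2[OF finp])
      fix z assume z: "z \<in> p - (p - q)"
      obtain t k where tk: "z = (t, k)" by force
      then show "0 \<le> (case z of (t, k) \<Rightarrow> \<epsilon> * (Sup k - Inf k))" 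
        using pk[of t k] z \<open>\<epsilon> > 0\<close> by auto
    qed auto
    also have "\<dots> = \<epsilon> * (b - a)"
      using additive_tagged_division_1[OF \<open>a \<le> b\<close> p(1), of "\<lambda>t. \<epsilon> * t"] by (simp add: right_diff_distrib)
    finally have gd: "(\<Sum>(t,k)\<in>p - q. f (Sup k) - f (Inf k)) \<le> \<epsilon> * (b - a)" .
    have "f b - f a = (\<Sum>(t,k)\<in>p. f (Sup k) - f (Inf k))"
      using additive_tagged_division_1[OF \<open>a \<le> b\<close> p(1), of f] by simp
    also have "\<dots> = (\<Sum>(t,k)\<in>p - q. f (Sup k) - f (Inf k)) + (\<Sum>(t,k)\<in>q. f (Sup k) - f (Inf k))"
      by (rule sum.subset_diff[OF _ finp]) (auto simp: q_def)
    finally show ?thesis using bad gd by (simp add: algebra_simps)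
  qed
  show ?thesis
  proof (rule ccontr)
    assume "\<not> f b \<le> f a"
    \<comment> \<open>Chosen so that the bound in \<open>main\<close> equals half of the supposed
      increase.\<close>
    define \<epsilon> where "\<epsilon> = (f b - f a) / (2 * (b - a + 1))"
    have "f b - f a > 0" and ab: "b - a + 1 > 0" using \<open>\<not> f b \<le> f a\<close> \<open>a \<le> b\<close> by auto
    then have "\<epsilon> > 0" by (simp add: \<epsilon>_def)
    moreover have "\<epsilon> * (b - a + 1) = (f b - f a) / 2"
      unfolding \<epsilon>_def using ab by (simp add: divide_simps)
    ultimately show False using main[of \<epsilon>] \<open>f b - f a > 0\<close> by simp
  qed
qed

text \<open>Barrier argument: after the last time \<open>s\<close> with \<open>w s \<le> M\<close>
  the function stays above \<open>M\<close>, hence has nonpositive derivative almost everywhere and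
  cannot climb above \<open>w s\<close>.\<close>

lemma abs_continuous_bounded_above:
  fixes w :: "real \<Rightarrow> real"
  assumes "0 \<le> T" and ac: "abs_continuous_on {0..T} w" and "w 0 \<le> M"
    and der: "AE t \<in> {0<..<T} in lebesgue. w t > M \<longrightarrow> (\<exists>D\<le>0. (w has_real_derivative D) (at t))"
  shows "w T \<le> M"
proof (rule ccontr)
  assume "\<not> w T \<le> M"
  define S where "S = {s \<in> {0..T}. w s \<le> M}"
  have cont: "continuous_on {0..T} w" using ac by (rule abs_continuous_on_imp_continuous_on)
  have "closed S" unfolding S_def
    using continuous_closed_preimage[OF cont, of "{..M}"] by (simp add: vimage_def Int_def)
  moreover have bdd: "bdd_above S" unfolding S_def by (rule bdd_aboveI[of _ T]) auto
  moreover have ne: "0 \<in> S" using assms unfolding S_def by auto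
  ultimately have sS: "Sup S \<in> S" using closed_contains_Sup by blast
  define s where "s = Sup S"
  have s: "s \<in> {0..T}" "w s \<le> M" using sS by (auto simp: S_def s_def)
  have above: "w t > M" if "t \<in> {s<..<T}" for t
  proof (rule ccontr)
    assume "\<not> w t > M"
    then have "t \<in> S" using that s by (auto simp: S_def)
    then have "t \<le> s" unfolding s_def using bdd by (simp add: cSup_upper)
    then show False using that by simp
  qed
  have "w T \<le> w s"
  proof (rule abs_continuous_nonincreasing[of s T w])
    show "s \<le> T" using s by simp
    show "abs_continuous_on {s..T} w" using s by (intro abs_continuous_on_subset[OF ac]) auto
    show "AE t \<in> {s<..<T} in lebesgue. \<exists>D\<le>0. (w has_real_derivative D) (at t)"
      using der by (rule eventually_mono) (use above s in auto)
  qed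
  then show False using s \<open>\<not> w T \<le> M\<close> by simp
qed

section \<open>Lyapunov forms for dissipative operators\<close>

text \<open>By homogeneity of degree two it suffices to look at the unit sphere of \<open>M\<close>,
  which is compact, so the positive continuous function \<open>b x x\<close> has a positive minimum
  there.\<close>

lemma bounded_bilinear_coercive_on_subspace:
  fixes b :: "'a::euclidean_space \<Rightarrow> 'a \<Rightarrow> real"
  assumes b: "bounded_bilinear b" and M: "subspace M"
    and pos: "\<And>x. x \<in> M \<Longrightarrow> x \<noteq> 0 \<Longrightarrow> 0 < b x x"
  obtains c where "c > 0" and "\<And>x. x \<in> M \<Longrightarrow> c * (norm x)\<^sup>2 \<le> b x x"
proof -
  interpret b: bounded_bilinear b by fact
  let ?S = "M \<inter> sphere 0 1"
  have cpt: "compact ?S" using closed_subspace[OF M] by (simp add: closed_Int_compact)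
  have "\<exists>c>0. \<forall>x\<in>?S. c \<le> b x x"
  proof (cases "?S = {}")
    case True
    then show ?thesis by (intro exI[of _ 1]) auto
  next
    case False
    have "continuous_on ?S (\<lambda>x. b x x)" by (intro b.continuous_on continuous_on_id)
    then obtain v where v: "v \<in> ?S" "\<forall>x\<in>?S. b v v \<le> b x x"
      using continuous_attains_inf[OF cpt False] by blast
    moreover have "0 < b v v" using v by (intro pos) auto
    ultimately show ?thesis by blast
  qed
  then obtain c where c: "c > 0" "\<And>x. x \<in> ?S \<Longrightarrow> c \<le> b x x" by blast
  have "c * (norm x)\<^sup>2 \<le> b x x" if "x \<in> M" for x
  proof (cases "x = 0")
    case True
    then show ?thesis by (simp add: b.zero_left)
  next
    case False
    have "c \<le> b (x /\<^sub>R norm x) (x /\<^sub>R norm x)"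
      using False that M by (intro c) (auto simp: subspace_scale)
    also have "\<dots> = b x x / (norm x)\<^sup>2"
      by (simp add: b.scaleR_left b.scaleR_right power2_eq_square divide_inverse)
    finally show ?thesis using False by (simp add: field_simps)
  qed
  with c(1) show thesis by (rule that)
qed

text \<open>The assumption \<open>triv\<close> is an observability condition: no nonzero invariant
  subspace of \<open>M\<close> escapes dissipation. Each summand of \<open>w\<close> dissipates
  \<open>d\<close> at another iterate of \<open>x\<close>, so the total vanishes only where all
  these iterates are lossless.\<close>

lemma strict_lyapunov_form:
  fixes A :: "'a::euclidean_space \<Rightarrow> 'a" and q :: "'a \<Rightarrow> 'a \<Rightarrow> real"
  assumes A: "linear A" and q: "bounded_bilinear q"
    and sym: "\<And>x y. q x y = q y x"
    and pos: "\<And>x. x \<noteq> 0 \<Longrightarrow> 0 < q x x"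
    and diss: "\<And>x. q (A x) x \<le> 0"
    and M: "subspace M"
    and triv: "\<And>N. subspace N \<Longrightarrow> N \<subseteq> M \<Longrightarrow> (\<And>x. x \<in> N \<Longrightarrow> A x \<in> N) \<Longrightarrow>
                 (\<And>x. x \<in> N \<Longrightarrow> q (A x) x = 0) \<Longrightarrow> N \<subseteq> {0}"
    and inv: "\<And>x. x \<in> M \<Longrightarrow> A x \<in> M"
  shows "\<exists>w c. bounded_bilinear w \<and> (\<forall>x y. w x y = w y x) \<and> c > 0 \<and>
    (\<forall>x\<in>M. c * (norm x)\<^sup>2 \<le> w x x \<and> w (A x) x \<le> - c * (norm x)\<^sup>2)"
proof -
  interpret q: bounded_bilinear q by fact
  define d where "d x = q (A x) x" for x
  have d_le: "d x \<le> 0" for x using diss by (simp add: d_def)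
  have d_scale: "d (r *\<^sub>R x) = r\<^sup>2 * d x" for r x
    by (simp add: d_def linear_cmul[OF A] q.scaleR_left q.scaleR_right power2_eq_square)
  \<comment> \<open>By the parallelogram law the zero set of the semidefinite quadratic form
    \<open>d\<close> is closed under addition.\<close>
  have d_add: "d (x + y) = 0" if "d x = 0" "d y = 0" for x y
  proof -
    have "d (x + y) + d (x - y) = 2 * d x + 2 * d y"
      by (simp add: d_def linear_add[OF A] linear_diff[OF A] q.add_left q.add_right
          q.diff_left q.diff_right)
    then show ?thesis using that d_le[of "x + y"] d_le[of "x - y"] by simp
  qed
  have lin: "linear (A ^^ k)" for k
    by (induction k) (simp_all only: funpow.simps linear_id linear_compose[OF _ A])
  have blin: "bounded_linear (A ^^ k)" for k using lin linear_conv_bounded_linear by blast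
  \<comment> \<open>Unit vectors of \<open>M\<close> with no visible dissipation up to order
    \<open>n\<close>. These sets are compact and decreasing, so if none were empty they would share
    a point.\<close>
  define Z where "Z n = {x \<in> M \<inter> sphere 0 1. \<forall>k\<le>n. d ((A ^^ k) x) = 0}" for n
  have "\<exists>n. Z n = {}"
  proof (rule ccontr)
    assume "\<not> (\<exists>n. Z n = {})"
    then have ne: "Z n \<noteq> {}" for n by blast
    have cd: "continuous_on UNIV (\<lambda>x. d ((A ^^ k) x))" for k
    proof -
      have "continuous_on UNIV (A ^^ k)" using blin by (rule linear_continuous_on)
      moreover have "continuous_on UNIV (\<lambda>x. A ((A ^^ k) x))"
        using linear_continuous_on[OF blin[of "Suc k"]] by simp
      ultimately show ?thesis unfolding d_def by (intro q.continuous_on)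
    qed
    have "compact (Z n)" for n
    proof -
      have "Z n = (M \<inter> sphere 0 1) \<inter> (\<Inter>k\<le>n. {x. d ((A ^^ k) x) = 0})"
        unfolding Z_def by auto
      moreover have "compact (M \<inter> sphere 0 1)"
        using closed_subspace[OF M] by (simp add: closed_Int_compact)
      moreover have "closed (\<Inter>k\<le>n. {x. d ((A ^^ k) x) = 0})"
        using cd by (intro closed_INT ballI closed_Collect_eq) auto
      ultimately show ?thesis by (simp add: compact_Int_closed)
    qed
    moreover have "m \<le> n \<Longrightarrow> Z n \<subseteq> Z m" for m n unfolding Z_def by auto
    ultimately have "\<Inter>(range Z) \<noteq> {}" using ne by (intro compact_nest) auto
    then obtain x where x: "\<And>n. x \<in> Z n" by blast
    \<comment> \<open>The unobservable subspace; shifting \<open>k\<close> by one shows its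
      invariance under \<open>A\<close>.\<close>
    define N where "N = {x \<in> M. \<forall>k. d ((A ^^ k) x) = 0}"
    have "N \<subseteq> {0}"
    proof (rule triv)
      show "subspace N"
        unfolding N_def subspace_def
      proof (intro conjI ballI allI; clarsimp)
        show "0 \<in> M \<and> (\<forall>k. d ((A ^^ k) 0) = 0)"
          using M by (simp add: subspace_0 linear_0[OF lin] d_def q.zero_right)
      next
        fix x y assume "x \<in> M" "\<forall>k. d ((A ^^ k) x) = 0" "y \<in> M" "\<forall>k. d ((A ^^ k) y) = 0"
        then show "x + y \<in> M \<and> (\<forall>k. d ((A ^^ k) (x + y)) = 0)"
          using M by (simp add: subspace_add linear_add[OF lin] d_add)
      next
        fix c x assume "x \<in> M" "\<forall>k. d ((A ^^ k) x) = 0"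
        then show "c *\<^sub>R x \<in> M \<and> (\<forall>k. d ((A ^^ k) (c *\<^sub>R x)) = 0)"
          using M by (simp add: subspace_scale linear_cmul[OF lin] d_scale)
      qed
      show "N \<subseteq> M" by (auto simp: N_def)
      show "A x \<in> N" if "x \<in> N" for x
      proof -
        have "d ((A ^^ k) (A x)) = 0" for k
        proof -
          have "d ((A ^^ Suc k) x) = 0" using that unfolding N_def by blast
          then show ?thesis by (simp add: funpow_swap1)
        qed
        then show ?thesis using that by (auto simp: N_def inv)
      qed
      show "q (A x) x = 0" if "x \<in> N" for x
      proof -
        have "d ((A ^^ 0) x) = 0" using that unfolding N_def by blast
        then show ?thesis by (simp add: d_def)
      qed
    qed
    moreover have "x \<in> N" "norm x = 1" using x by (auto simp: Z_def N_def)
    ultimately show False by auto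
  qed
  then obtain n where n: "Z n = {}" by blast
  have strict: "\<exists>k\<le>n. d ((A ^^ k) x) \<noteq> 0" if x: "x \<in> M" "x \<noteq> 0" for x
  proof (rule ccontr)
    assume "\<not> ?thesis"
    then have "x /\<^sub>R norm x \<in> Z n"
      using x M by (auto simp: Z_def subspace_scale linear_cmul[OF lin] d_scale)
    then show False using n by blast
  qed
  \<comment> \<open>The term \<open>k = 0\<close> alone makes \<open>w\<close> positive definite;
    the later terms detect dissipation that \<open>d\<close> misses at \<open>x\<close>
    itself.\<close>
  define w where "w x y = (\<Sum>k\<le>n. q ((A ^^ k) x) ((A ^^ k) y))" for x y
  have w: "bounded_bilinear w"
    unfolding bilinear_conv_bounded_bilinear[symmetric] bilinear_def w_def
    by (intro conjI allI linearI)
       (auto simp: linear_add[OF lin] linear_cmul[OF lin] q.add_left q.add_right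
          q.scaleR_left q.scaleR_right sum.distrib sum_distrib_left)
  interpret w: bounded_bilinear w by fact
  have w_sym: "w x y = w y x" for x y by (simp add: w_def sym)
  have qnn: "0 \<le> q x x" for x using pos[of x] by (cases "x = 0") (auto simp: q.zero_left)
  have w_pos: "0 < w x x" if "x \<noteq> 0" for x
  proof -
    have "q ((A ^^ 0) x) ((A ^^ 0) x) \<le> w x x"
      unfolding w_def by (rule member_le_sum) (auto simp: qnn)
    then show ?thesis using pos[OF that] by simp
  qed
  have wA: "w (A x) x = (\<Sum>k\<le>n. d ((A ^^ k) x))" for x
    unfolding w_def d_def by (simp add: funpow_swap1)
  have w_neg: "0 < - w (A x) x" if x: "x \<in> M" "x \<noteq> 0" for x
  proof -
    obtain k where "k \<le> n" "d ((A ^^ k) x) \<noteq> 0" using strict[OF x] by blast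
    then have "(\<Sum>k\<le>n. - d ((A ^^ k) x)) > 0"
      using d_le by (intro sum_pos2[of _ k]) (auto simp: less_le)
    then show ?thesis by (simp add: wA sum_negf)
  qed
  have "bounded_bilinear (\<lambda>x y. - w (A x) y)"
    unfolding bilinear_conv_bounded_bilinear[symmetric] bilinear_def
    by (intro conjI allI linearI)
       (auto simp: linear_add[OF A] linear_cmul[OF A] w.add_left w.add_right
          w.scaleR_left w.scaleR_right)
  then obtain c2 where c2: "c2 > 0" "\<And>x. x \<in> M \<Longrightarrow> c2 * (norm x)\<^sup>2 \<le> - w (A x) x"
    using bounded_bilinear_coercive_on_subspace[OF _ M, of "\<lambda>x y. - w (A x) y"] w_neg by blast
  obtain c1 where c1: "c1 > 0" "\<And>x. x \<in> M \<Longrightarrow> c1 * (norm x)\<^sup>2 \<le> w x x"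
    using bounded_bilinear_coercive_on_subspace[OF w M] w_pos by blast
  have *: "min c1 c2 * (norm x)\<^sup>2 \<le> c1 * (norm x)\<^sup>2" "min c1 c2 * (norm x)\<^sup>2 \<le> c2 * (norm x)\<^sup>2" for x :: 'a
    by (auto intro: mult_right_mono)
  have "min c1 c2 * (norm x)\<^sup>2 \<le> w x x \<and> w (A x) x \<le> - min c1 c2 * (norm x)\<^sup>2" if "x \<in> M" for x
    using *[of x] c1(2)[OF that] c2(2)[OF that] by auto
  moreover have "min c1 c2 > 0" using c1 c2 by simp
  ultimately show ?thesis using w w_sym by blast
qed

section \<open>Extremal vectors and orthogonal projection for an inner product\<close>

text \<open>On \<open>N\<close> the square of \<open>A\<close> is self-adjoint and negative
  semidefinite for \<open>q\<close>, so a maximiser of the Rayleigh quotient of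
  \<open>q (A x) (A x)\<close> is an eigenvector of it.\<close>

lemma skew_on_subspace_eigenvector:
  fixes A :: "'a::euclidean_space \<Rightarrow> 'a" and q :: "'a \<Rightarrow> 'a \<Rightarrow> real"
  assumes A: "linear A" and q: "bounded_bilinear q"
    and sym: "\<And>x y. q x y = q y x"
    and pos: "\<And>x. x \<noteq> 0 \<Longrightarrow> 0 < q x x"
    and N: "subspace N" and inv: "\<And>x. x \<in> N \<Longrightarrow> A x \<in> N"
    and skew: "\<And>x. x \<in> N \<Longrightarrow> q (A x) x = 0"
    and nontriv: "\<not> N \<subseteq> {0}"
  obtains v \<alpha> where "v \<in> N" "v \<noteq> 0" "A (A v) = - (\<alpha>\<^sup>2) *\<^sub>R v"
proof -
  interpret q: bounded_bilinear q by fact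
  \<comment> \<open>Polarisation: vanishing of the quadratic form on \<open>N\<close> makes
    \<open>A\<close> skew-adjoint there.\<close>
  have polar: "q (A x) y = - q x (A y)" if "x \<in> N" "y \<in> N" for x y
    using skew[of "x + y"] skew[of x] skew[of y] that N
    by (simp add: subspace_add linear_add[OF A] q.add_left q.add_right sym[of x])
  let ?S = "{x \<in> N. q x x = 1}"
  obtain c where c: "c > 0" "\<And>x. x \<in> N \<Longrightarrow> c * (norm x)\<^sup>2 \<le> q x x"
    using bounded_bilinear_coercive_on_subspace[OF q N] pos by blast
  have qc: "continuous_on UNIV (\<lambda>x. q x x)" by (intro q.continuous_on continuous_on_id)
  have "compact ?S"
    unfolding compact_eq_bounded_closed
  proof
    have "norm x \<le> sqrt (1 / c)" if "x \<in> ?S" for x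
      using c(2)[of x] c(1) that by (intro real_le_rsqrt) (auto simp: field_simps)
    then show "bounded ?S" unfolding bounded_iff by blast
    have "?S = N \<inter> {x. q x x = 1}" by auto
    moreover have "closed {x. q x x = 1}" using qc by (intro closed_Collect_eq) auto
    ultimately show "closed ?S" using closed_subspace[OF N] by (simp add: closed_Int)
  qed
  have normalise: "x /\<^sub>R sqrt (q x x) \<in> ?S" if "x \<in> N" "x \<noteq> 0" for x
    using that N pos[OF that(2)] by (simp add: subspace_scale q.scaleR_left q.scaleR_right field_simps)
  then have ne: "?S \<noteq> {}" using nontriv by blast
  have "continuous_on UNIV A" using A linear_conv_bounded_linear linear_continuous_on by blast
  then have "continuous_on ?S (\<lambda>x. q (A x) (A x))"
    by (intro q.continuous_on continuous_on_subset[OF \<open>continuous_on UNIV A\<close>]) auto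
  then obtain v where v: "v \<in> ?S" and max: "\<And>x. x \<in> ?S \<Longrightarrow> q (A x) (A x) \<le> q (A v) (A v)"
    using continuous_attains_sup[OF \<open>compact ?S\<close> ne] by blast
  define \<mu> where "\<mu> = q (A v) (A v)"
  have \<mu>: "0 \<le> \<mu>" using pos[of "A v"] unfolding \<mu>_def by (cases "A v = 0") (auto simp: q.zero_left)
  have vN: "v \<in> N" and "v \<noteq> 0" using v by (auto simp: q.zero_left)
  \<comment> \<open>By maximality of \<open>v\<close> this form is positive semidefinite on
    \<open>N\<close> and vanishes at \<open>v\<close>. Then \<open>h v\<close> vanishes on all of
    \<open>N\<close>, which replaces a Lagrange multiplier argument.\<close>
  define h where "h x y = \<mu> * q x y - q (A x) (A y)" for x y
  have h_nn: "0 \<le> h x x" if "x \<in> N" for x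
  proof (cases "x = 0")
    case True
    then show ?thesis by (simp add: h_def q.zero_left linear_0[OF A])
  next
    case False
    have "q (A (x /\<^sub>R sqrt (q x x))) (A (x /\<^sub>R sqrt (q x x))) \<le> \<mu>"
      using max normalise[OF that False] unfolding \<mu>_def by blast
    then have "q (A x) (A x) / q x x \<le> \<mu>"
      using pos[OF False] by (simp add: linear_cmul[OF A] q.scaleR_left q.scaleR_right field_simps)
    then show ?thesis using pos[OF False] by (simp add: h_def field_simps)
  qed
  have hv: "h v v = 0" using v by (simp add: h_def \<mu>_def)
  have hv0: "h v y = 0" if y: "y \<in> N" for y
  proof (rule ccontr)
    assume ne: "h v y \<noteq> 0"
    have "h (y + t *\<^sub>R v) (y + t *\<^sub>R v) = h y y + 2 * t * h v y + t\<^sup>2 * h v v" for t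
      by (simp add: h_def linear_add[OF A] linear_cmul[OF A] q.add_left q.add_right q.scaleR_left
          q.scaleR_right sym[of y v] sym[of "A y" "A v"] algebra_simps power2_eq_square)
    moreover have "0 \<le> h (y + t *\<^sub>R v) (y + t *\<^sub>R v)" for t
      using y vN N by (intro h_nn) (simp add: subspace_add subspace_scale)
    ultimately have "0 \<le> h y y + 2 * t * h v y" for t using hv by simp
    \<comment> \<open>As \<open>h v v = 0\<close>, the expression is affine in \<open>t\<close>;
      this value of \<open>t\<close> makes it -1.\<close>
    from this[of "- (h y y + 1) / (2 * h v y)"] show False using ne by (simp add: field_simps)
  qed
  \<comment> \<open>Moving one \<open>A\<close> across \<open>q\<close> gives
    \<open>q e y = h v y\<close> for \<open>y\<close> in \<open>N\<close>; thus \<open>e\<close> is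
    a vector of \<open>N\<close> orthogonal to \<open>N\<close>.\<close>
  define e where "e = \<mu> *\<^sub>R v + A (A v)"
  have eN: "e \<in> N" using vN N inv by (simp add: e_def subspace_add subspace_scale)
  have "q e y = h v y" if "y \<in> N" for y
    using polar[OF inv[OF vN] that] by (simp add: e_def h_def q.add_left q.scaleR_left)
  then have "q e e = 0" using hv0 eN by simp
  then have "e = 0" using pos[of e] by fastforce
  then have "A (A v) = - ((sqrt \<mu>)\<^sup>2) *\<^sub>R v"
    using \<mu> unfolding e_def by (simp add: add_eq_0_iff)
  with vN \<open>v \<noteq> 0\<close> show thesis by (rule that)
qed

text \<open>The point of \<open>S\<close> closest to \<open>x\<close> in the norm of
  \<open>q\<close> exists by compactness, and the residual is the required component.
  \<open>P\<close> projects along \<open>S\<close>, not onto it; its linearity follows from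
  uniqueness of the decomposition.\<close>

lemma bounded_bilinear_orthogonal_projection:
  fixes q :: "'a::euclidean_space \<Rightarrow> 'a \<Rightarrow> real"
  assumes q: "bounded_bilinear q" and sym: "\<And>x y. q x y = q y x"
    and pos: "\<And>x. x \<noteq> 0 \<Longrightarrow> 0 < q x x"
    and S: "subspace S"
  shows "\<exists>P. linear P \<and> (\<forall>x. \<forall>y\<in>S. q (P x) y = 0) \<and> (\<forall>x. x - P x \<in> S) \<and>
    (\<forall>x\<in>S. P x = 0) \<and> (\<forall>x. (\<forall>y\<in>S. q x y = 0) \<longrightarrow> P x = x)"
proof -
  interpret q: bounded_bilinear q by fact
  define pr where "pr x m \<longleftrightarrow> (\<forall>y\<in>S. q m y = 0) \<and> x - m \<in> S" for x m
  have uniq: "m = m'" if "pr x m" "pr x m'" for x m m'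
  proof -
    have "x - m \<in> S" "x - m' \<in> S" using that by (simp_all add: pr_def)
    from subspace_diff[OF S this(2,1)]
    have "m - m' \<in> S" by simp
    moreover have "q (m - m') y = 0" if "y \<in> S" for y
      using \<open>pr x m\<close> \<open>pr x m'\<close> that by (simp add: pr_def q.diff_left)
    ultimately have "q (m - m') (m - m') = 0" by blast
    then show ?thesis using pos[of "m - m'"] by fastforce
  qed
  have ex: "\<exists>m. pr x m" for x
  proof -
    obtain c where c: "c > 0" "\<And>y. y \<in> UNIV \<Longrightarrow> c * (norm y)\<^sup>2 \<le> q y y"
      using bounded_bilinear_coercive_on_subspace[OF q subspace_UNIV] pos by blast
    \<comment> \<open>Only points no farther from \<open>x\<close> than the origin can compete, and
      coercivity makes this set bounded.\<close>
    define C where "C = {y \<in> S. q (x - y) (x - y) \<le> q x x}"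
    have cont: "continuous_on UNIV (\<lambda>y. q (x - y) (x - y))" by (intro q.continuous_on continuous_intros)
    have "compact C" unfolding compact_eq_bounded_closed
    proof
      have "norm y \<le> norm x + sqrt (q x x / c)" if "y \<in> C" for y
      proof -
        have "norm (x - y) \<le> sqrt (q x x / c)"
          using c(2)[of "x - y"] c(1) that unfolding C_def
          by (intro real_le_rsqrt) (auto simp: field_simps)
        then show ?thesis using norm_triangle_ineq2[of y x] by (simp add: norm_minus_commute)
      qed
      then show "bounded C" unfolding bounded_iff by blast
      have "C = S \<inter> {y. q (x - y) (x - y) \<le> q x x}" by (auto simp: C_def)
      moreover have "closed {y. q (x - y) (x - y) \<le> q x x}"
        using cont by (intro closed_Collect_le) auto
      ultimately show "closed C" using closed_subspace[OF S] by (simp add: closed_Int)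
    qed
    moreover have "0 \<in> C" using S by (simp add: C_def subspace_0)
    moreover have "continuous_on C (\<lambda>y. q (x - y) (x - y))" using cont continuous_on_subset by blast
    ultimately obtain m where m: "m \<in> C" and mC: "\<And>y. y \<in> C \<Longrightarrow> q (x - m) (x - m) \<le> q (x - y) (x - y)"
      using continuous_attains_inf[of C "\<lambda>y. q (x - y) (x - y)"] by blast
    have mS: "m \<in> S" using m by (simp add: C_def)
    have min: "q (x - m) (x - m) \<le> q (x - y) (x - y)" if "y \<in> S" for y
      using mC[of y] m that by (force simp: C_def)
    have "q (x - m) y = 0" if y: "y \<in> S" for y
    proof (rule ccontr)
      let ?b = "q (x - m) y"
      assume b: "?b \<noteq> 0"
      then have "y \<noteq> 0" by (auto simp: q.zero_right)
      then have a: "q y y > 0" by (rule pos)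
      \<comment> \<open>The minimiser of the squared distance along the direction \<open>y\<close>;
        it would improve on \<open>m\<close> unless \<open>?b = 0\<close>.\<close>
      define t where "t = ?b / q y y"
      have "m + t *\<^sub>R y \<in> S" using mS y S by (simp add: subspace_add subspace_scale)
      then have "q (x - m) (x - m) \<le> q (x - m - t *\<^sub>R y) (x - m - t *\<^sub>R y)"
        using min by (simp add: diff_diff_eq)
      also have "\<dots> = q (x - m) (x - m) - 2 * t * ?b + t * t * q y y"
        using sym[of y "x - m"] 
        by (simp add: q.diff_left[of "x - m"] q.diff_right[of _ "x - m"] q.scaleR_left q.scaleR_right right_diff_distrib)
      finally have "2 * t * ?b \<le> t * t * q y y" by simp
      then have "?b * ?b \<le> 0" using a unfolding t_def by (simp add: field_simps)
      then show False using b by (metis mult_eq_0_iff not_square_less_zero order_le_less)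
    qed
    then show ?thesis using mS unfolding pr_def by (intro exI[of _ "x - m"]) auto
  qed
  define P where "P x = (SOME m. pr x m)" for x
  have P: "pr x (P x)" for x unfolding P_def using someI_ex[OF ex] .
  have PI: "P x = m" if "pr x m" for x m using uniq[OF P that] .
  have "linear P"
  proof (rule linearI)
    fix x y
    have "(x - P x) + (y - P y) \<in> S" using P by (intro subspace_add[OF S]) (simp_all add: pr_def)
    then show "P (x + y) = P x + P y"
      using P by (intro PI) (auto simp: pr_def q.add_left algebra_simps)
  next
    fix r x
    have "r *\<^sub>R (x - P x) \<in> S" using P by (intro subspace_scale[OF S]) (auto simp: pr_def)
    then show "P (r *\<^sub>R x) = r *\<^sub>R P x"
      using P by (intro PI) (auto simp: pr_def q.scaleR_left scaleR_diff_right)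
  qed
  moreover have "q (P x) y = 0" if "y \<in> S" for x y using P that by (auto simp: pr_def)
  moreover have "x - P x \<in> S" for x using P by (auto simp: pr_def)
  moreover have "P x = 0" if "x \<in> S" for x using that by (intro PI) (auto simp: pr_def q.zero_left)
  moreover have "P x = x" if "\<forall>y\<in>S. q x y = 0" for x
    using that S by (intro PI) (auto simp: pr_def subspace_0)
  ultimately show ?thesis by blast
qed

section \<open>Port-Hamiltonian systems\<close>

text \<open>The difference splits as \<open>b x (x - y) + b (x - y) y\<close>, and each part is
  bounded by \<open>r * K\<close> times the distance.\<close>

lemma bounded_bilinear_lipschitz_on_bounded:
  fixes b :: "'a::real_normed_vector \<Rightarrow> 'a \<Rightarrow> real"
  assumes "bounded_bilinear b" and "bounded S"
  obtains L where "L-lipschitz_on S (\<lambda>x. b x x)"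
proof -
  interpret b: bounded_bilinear b by fact
  obtain K where K: "K > 0" "\<And>x y. norm (b x y) \<le> norm x * norm y * K"
    using b.pos_bounded by blast
  obtain r where r: "r > 0" "\<And>x. x \<in> S \<Longrightarrow> norm x \<le> r"
    using assms(2) bounded_pos by blast
  have "(2 * r * K)-lipschitz_on S (\<lambda>x. b x x)"
  proof (rule lipschitz_onI)
    fix x y assume xy: "x \<in> S" "y \<in> S"
    have "b x x - b y y = b x (x - y) + b (x - y) y"
      by (simp add: b.diff_left b.diff_right)
    then have "dist (b x x) (b y y) \<le> norm (b x (x - y)) + norm (b (x - y) y)"
      by (simp add: dist_norm)
    also have "\<dots> \<le> norm x * norm (x - y) * K + norm (x - y) * norm y * K"
      by (intro add_mono K)
    also have "\<dots> = (norm x + norm y) * (norm (x - y) * K)" by (simp add: algebra_simps)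
    also have "\<dots> \<le> (2 * r) * (norm (x - y) * K)"
      using r(2)[OF xy(1)] r(2)[OF xy(2)] K by (intro mult_right_mono) auto
    finally show "dist (b x x) (b y y) \<le> 2 * r * K * dist x y" by (simp add: dist_norm mult_ac)
  qed (use r K in auto)
  then show thesis by (rule that)
qed

lemma matrix_vector_inner_transpose:
  fixes M :: "real^'n^'m"
  shows "(M *v x) \<bullet> y = x \<bullet> (transpose M *v y)"
  by (metis dot_lmul_matrix inner_commute transpose_matrix_vector)

text \<open>Otherwise a small step from \<open>x\<close> along \<open>- R *v x\<close> would make
  the form negative, its first-order change being strictly negative.\<close>

lemma pos_semidef_inner_eq_0:
  fixes R :: "real^'n^'n"
  assumes sym: "transpose R = R" and psd: "pos_semidef R" and 0: "(R *v x) \<bullet> x = 0"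
  shows "R *v x = 0"
proof (rule ccontr)
  assume ne: "R *v x \<noteq> 0"
  define y where "y = R *v x"
  define k where "k = (R *v y) \<bullet> y"
  have k: "k \<ge> 0" using psd by (simp add: k_def pos_semidef_def)
  have y: "y \<bullet> y > 0" using ne by (simp add: y_def)
  have "(R *v y) \<bullet> x = y \<bullet> y"
    using matrix_vector_inner_transpose[of R y x] sym by (simp add: y_def)
  then have expand: "(R *v (x - s *\<^sub>R y)) \<bullet> (x - s *\<^sub>R y) = s * (s * k) - 2 * s * (y \<bullet> y)" for s
    using 0 by (simp add: k_def matrix_vector_mult_diff_distrib matrix_vector_mult_scaleR
        inner_diff_left inner_diff_right algebra_simps flip: y_def)
  \<comment> \<open>Small enough that the quadratic term \<open>s * k\<close> stays below
    \<open>y \<bullet> y\<close>; the summand 1 covers \<open>k = 0\<close>.\<close>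
  define s where "s = (y \<bullet> y) / (k + 1)"
  have "0 \<le> s * (s * k - 2 * (y \<bullet> y))"
    using psd expand[of s] unfolding pos_semidef_def by (metis right_diff_distrib mult.assoc mult.left_commute)
  moreover have "s > 0" using y k by (simp add: s_def)
  ultimately have "2 * (y \<bullet> y) \<le> s * k" by (simp add: zero_le_mult_iff)
  also have "\<dots> \<le> y \<bullet> y" using k y by (simp add: s_def field_simps)
  finally show False using y by simp
qed

section \<open>Imaginary eigenvalues and the conservative subspace\<close>

lemma mat_mult_vector: "mat k *v z = k *s (z :: 'a::comm_semiring_1^'n)"
  by (simp add: vec_eq_iff matrix_vector_mult_def mat_def if_distrib[of "\<lambda>t. t * _"] cong: if_cong)

lemma matrix_kernel_imaginary_iff:
  fixes A :: "real^'n^'n"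
  shows "z \<in> matrix_kernel (map_matrix complex_of_real A - mat (\<i> * complex_of_real \<alpha>)) \<longleftrightarrow>
    A *v Re_vec z = - \<alpha> *\<^sub>R Im_vec z \<and> A *v Im_vec z = \<alpha> *\<^sub>R Re_vec z"
proof -
  have "z \<in> matrix_kernel (map_matrix complex_of_real A - mat (\<i> * complex_of_real \<alpha>)) \<longleftrightarrow>
     map_matrix complex_of_real A *v z = (\<i> * complex_of_real \<alpha>) *s z"
    by (simp add: matrix_kernel_def matrix_vector_mult_diff_rdistrib mat_mult_vector)
  also have "\<dots> \<longleftrightarrow> (\<forall>i. (\<Sum>j\<in>UNIV. complex_of_real (A $ i $ j) * z $ j) = \<i> * complex_of_real \<alpha> * z $ i)"
    by (simp add: vec_eq_iff matrix_vector_mult_def map_matrix_def)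
  also have "\<dots> \<longleftrightarrow> (\<forall>i. (\<Sum>j\<in>UNIV. A $ i $ j * Re (z $ j)) = - \<alpha> * Im (z $ i) \<and>
      (\<Sum>j\<in>UNIV. A $ i $ j * Im (z $ j)) = \<alpha> * Re (z $ i))"
    by (simp add: complex_eq_iff)
  also have "\<dots> \<longleftrightarrow> A *v Re_vec z = - \<alpha> *\<^sub>R Im_vec z \<and> A *v Im_vec z = \<alpha> *\<^sub>R Re_vec z"
    by (auto simp: vec_eq_iff matrix_vector_mult_def Re_vec_def Im_vec_def)
  finally show ?thesis .
qed

lemma subspace_conservative_subspace: "subspace (conservative_subspace A)"
  by (simp add: conservative_subspace_def)

lemma eigenvector_parts_in_conservative_subspace:
  fixes A :: "real^'n^'n" and \<alpha> :: real
  assumes z: "z \<in> matrix_kernel (map_matrix complex_of_real A - mat (\<i> * complex_of_real \<alpha>))"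
  shows "Re_vec z \<in> conservative_subspace A" "Im_vec z \<in> conservative_subspace A"
proof -
  have "Re_vec z \<in> conservative_subspace A \<and> Im_vec z \<in> conservative_subspace A"
  \<comment> \<open>Zero lies in every kernel, whereas \<open>spectrum\<close> demands a nonzero
    eigenvector.\<close>
  proof (cases "z = 0")
    case True
    then have "Re_vec z = 0" "Im_vec z = 0" by (simp_all add: Re_vec_def Im_vec_def vec_eq_iff)
    then show ?thesis using subspace_0[OF subspace_conservative_subspace] by metis
  next
    case False
    have "map_matrix complex_of_real A *v z = (\<i> * complex_of_real \<alpha>) *s z"
      using z by (simp add: matrix_kernel_def matrix_vector_mult_diff_rdistrib mat_mult_vector)
    then have "\<i> * complex_of_real \<alpha> \<in> spectrum A"
      using False unfolding spectrum_def by blast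
    moreover have "Re_vec z \<in> real_eigenspace A (\<i> * complex_of_real \<alpha>)"
      "Im_vec z \<in> real_eigenspace A (\<i> * complex_of_real \<alpha>)"
      unfolding real_eigenspace_def using z by (auto intro!: span_base)
    ultimately show ?thesis
      unfolding conservative_subspace_def by (auto intro!: span_base)
  qed
  then show "Re_vec z \<in> conservative_subspace A" "Im_vec z \<in> conservative_subspace A" by auto
qed

text \<open>Serves as an induction principle through the two nested spans.\<close>

lemma conservative_subspace_minimal:
  fixes A :: "real^'n^'n"
  assumes "subspace X"
    and "\<And>\<alpha> z. z \<in> matrix_kernel (map_matrix complex_of_real A - mat (\<i> * complex_of_real \<alpha>)) \<Longrightarrow>
           Re_vec z \<in> X \<and> Im_vec z \<in> X"
  shows "conservative_subspace A \<subseteq> X"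
  unfolding conservative_subspace_def
proof (rule span_minimal[OF _ assms(1)], intro UN_least)
  fix \<alpha> :: real
  show "real_eigenspace A (\<i> * complex_of_real \<alpha>) \<subseteq> X"
    unfolding real_eigenspace_def
    by (rule span_minimal[OF _ assms(1)]) (use assms(2) in blast)
qed

text \<open>For nonzero \<alpha> the vector \<open>\<alpha> v - i A v\<close> is an eigenvector for
  \<open>i \<alpha>\<close>, with real part \<open>\<alpha> v\<close>. For \<alpha> = 0 the squared
  equation would admit a Jordan block, which \<open>zero\<close> excludes.\<close>

lemma skew_eigenvector_in_conservative_subspace:
  fixes A :: "real^'n^'n"
  assumes ev: "A *v (A *v v) = - (\<alpha>\<^sup>2) *\<^sub>R v" and zero: "\<alpha> = 0 \<Longrightarrow> A *v v = 0"
  shows "v \<in> conservative_subspace A"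
proof (cases "\<alpha> = 0")
  case True
  define z :: "complex^'n" where "z = (\<chi> i. complex_of_real (v $ i))"
  have z: "Re_vec z = v" "Im_vec z = 0" by (simp_all add: z_def Re_vec_def Im_vec_def vec_eq_iff)
  then have "z \<in> matrix_kernel (map_matrix complex_of_real A - mat (\<i> * complex_of_real 0))"
    unfolding matrix_kernel_imaginary_iff using zero True by simp
  from eigenvector_parts_in_conservative_subspace(1)[OF this] show ?thesis using z by simp
next
  case False
  define z :: "complex^'n" where "z = (\<chi> i. Complex (\<alpha> * v $ i) (- (A *v v) $ i))"
  have z: "Re_vec z = \<alpha> *\<^sub>R v" "Im_vec z = - (A *v v)"
    by (simp_all add: z_def Re_vec_def Im_vec_def vec_eq_iff)
  have "A *v (- (A *v v)) = - (A *v (A *v v))"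
    using matrix_vector_mult_scaleR[of A "-1" "A *v v"] by simp
  then have "z \<in> matrix_kernel (map_matrix complex_of_real A - mat (\<i> * complex_of_real \<alpha>))"
    unfolding matrix_kernel_imaginary_iff z using ev
    by (simp add: matrix_vector_mult_scaleR power2_eq_square)
  from eigenvector_parts_in_conservative_subspace(1)[OF this]
  have "\<alpha> *\<^sub>R v \<in> conservative_subspace A" using z by simp
  from subspace_scale[OF subspace_conservative_subspace this, of "1 / \<alpha>"] show ?thesis using False by simp
qed

section \<open>Boundedness of the dissipative component\<close>

text \<open>Since \<open>P\<close> commutes with \<open>A\<close>, the component \<open>P x\<close>
  obeys a system of its own with bounded input. Far from the origin its quadratic dissipation
  outweighs the input, whose contribution grows only linearly.\<close>

lemma bounded_input_bounded_state:
  fixes A :: "real^'n^'n" and B :: "real^'m^'n"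
    and P :: "real^'n \<Rightarrow> real^'n" and w :: "real^'n \<Rightarrow> real^'n \<Rightarrow> real"
  assumes U: "bounded U" and P: "linear P" and PA: "\<And>x. P (A *v x) = A *v P x"
    and w: "bounded_bilinear w" and sym: "\<And>x y. w x y = w y x" and "c > 0"
    and low: "\<And>x. c * (norm (P x))\<^sup>2 \<le> w (P x) (P x)"
    and dec: "\<And>x. w (A *v P x) (P x) \<le> - c * (norm (P x))\<^sup>2"
  obtains \<rho> where "\<And>y. y \<in> reachable_set A B U x0 \<Longrightarrow> norm (P y) \<le> \<rho>"
proof -
  interpret w: bounded_bilinear w by fact
  have bP: "bounded_linear P" using P linear_conv_bounded_linear by blast
  obtain K where K: "K > 0" "\<And>x y. norm (w x y) \<le> norm x * norm y * K"
    using w.pos_bounded by blast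
  have "linear (\<lambda>u. P (B *v u))"
    using linear_compose[OF matrix_vector_mul_linear P] by (simp add: o_def)
  then have "bounded ((\<lambda>u. P (B *v u)) ` U)"
    using U linear_conv_bounded_linear bounded_linear_image by blast
  then obtain \<beta> where \<beta>: "\<beta> > 0" "\<And>u. u \<in> U \<Longrightarrow> norm (P (B *v u)) \<le> \<beta>"
    unfolding bounded_pos by blast
  \<comment> \<open>Beyond this norm of \<open>y\<close> the dissipation
    \<open>c * (norm y)\<^sup>2\<close> dominates the input term
    \<open>K * \<beta> * norm y\<close>.\<close>
  define r where "r = K * \<beta> / c"
  define g where "g x y = w (P x) (P y)" for x y
  have g: "bounded_bilinear g" unfolding g_def using w.comp[OF bP bP] .
  \<comment> \<open>Covers the initial value and bounds \<open>w\<close> on the ball of radius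
    \<open>r\<close>, so that a value above \<open>M\<close> forces a norm above
    \<open>r\<close>.\<close>
  define M where "M = max (g x0 x0) (K * r\<^sup>2)"
  have "r > 0" using \<beta> K \<open>c > 0\<close> by (simp add: r_def)
  have decrease: "2 * g (A *v x + B *v u) x \<le> 0" if u: "u \<in> U" and big: "g x x > M" for x u
  proof -
    define y where "y = P x"
    have "K * r\<^sup>2 < w y y" using big by (simp add: M_def g_def y_def)
    also have "\<dots> \<le> K * (norm y)\<^sup>2" using K(2)[of y y] by (simp add: power2_eq_square mult_ac)
    finally have "r\<^sup>2 < (norm y)\<^sup>2" using K(1) by simp
    then have "r < norm y" by (rule power_less_imp_less_base) simp
    then have "K * \<beta> \<le> c * norm y" using \<open>c > 0\<close> by (simp add: r_def field_simps)
    then have "norm y * (K * \<beta>) \<le> norm y * (c * norm y)" by (intro mult_left_mono) auto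
    moreover have "w (P (B *v u)) y \<le> norm y * (K * \<beta>)"
    proof -
      have "w (P (B *v u)) y \<le> norm (P (B *v u)) * norm y * K" using K(2)[of "P (B *v u)" y] by simp
      also have "\<dots> \<le> \<beta> * norm y * K" using \<beta>(2)[OF u] K by (intro mult_right_mono) auto
      finally show ?thesis by (simp add: mult_ac)
    qed
    moreover have "g (A *v x + B *v u) x = w (A *v y) y + w (P (B *v u)) y"
      by (simp add: g_def linear_add[OF P] PA w.add_left y_def)
    ultimately show ?thesis using dec[of x] by (simp add: y_def power2_eq_square algebra_simps)
  qed
  have "norm (P y) \<le> sqrt (M / c)" if "y \<in> reachable_set A B U x0" for y
  proof -
    obtain T u x where y: "y = x T" and T: "0 \<le> T" and u: "u \<in> admissible_controls T U"
      and sol: "is_solution A B T x0 u x"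
      using \<open>y \<in> _\<close> unfolding reachable_set_def by blast
    have ac: "abs_continuous_on {0..T} x" and x0: "x 0 = x0"
      and der: "AE t \<in> {0<..<T} in lebesgue. (x has_vector_derivative (A *v x t + B *v u t)) (at t)"
      using sol by (auto simp: is_solution_def)
    \<comment> \<open>The constant \<open>L\<close> may depend on the trajectory and on
      \<open>T\<close>; the bound \<open>M\<close> does not.\<close>
    have "bounded (x ` {0..T})"
      using abs_continuous_on_imp_continuous_on[OF ac] compact_continuous_image compact_imp_bounded by blast
    then obtain L where L: "L-lipschitz_on (x ` {0..T}) (\<lambda>v. g v v)"
      using bounded_bilinear_lipschitz_on_bounded[OF g] by blast
    have "g (x T) (x T) \<le> M"
    proof (rule abs_continuous_bounded_above[OF T abs_continuous_on_Lipschitz_compose[OF ac L]])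
      show "g (x 0) (x 0) \<le> M" by (simp add: x0 M_def)
      show "AE t \<in> {0<..<T} in lebesgue. M < g (x t) (x t) \<longrightarrow>
          (\<exists>D\<le>0. ((\<lambda>t. g (x t) (x t)) has_real_derivative D) (at t))"
        using der
      proof (rule eventually_mono, intro impI)
        fix t
        assume t: "t \<in> {0<..<T} \<longrightarrow> (x has_vector_derivative (A *v x t + B *v u t)) (at t)"
          "t \<in> {0<..<T}" "M < g (x t) (x t)"
        let ?x' = "A *v x t + B *v u t"
        have "(x has_vector_derivative ?x') (at t)" using t by blast
        then have "((\<lambda>t. g (x t) (x t)) has_vector_derivative g (x t) ?x' + g ?x' (x t)) (at t)"
          using bounded_bilinear.has_vector_derivative[OF g] by blast
        moreover have "g (x t) ?x' = g ?x' (x t)" by (simp add: g_def sym)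
        ultimately have "((\<lambda>t. g (x t) (x t)) has_real_derivative 2 * g ?x' (x t)) (at t)"
          by (simp add: has_real_derivative_iff_has_vector_derivative)
        moreover have "u t \<in> U" using u t by (auto simp: admissible_controls_def)
        ultimately show "\<exists>D\<le>0. ((\<lambda>t. g (x t) (x t)) has_real_derivative D) (at t)"
          using decrease t(3) by blast
      qed
    qed
    then have "c * (norm (P y))\<^sup>2 \<le> M" using low[of y] by (simp add: g_def y)
    then show ?thesis using \<open>c > 0\<close> by (intro real_le_rsqrt) (simp add: field_simps)
  qed
  then show thesis by (rule that)
qed

theorem corollary5:
  fixes J R Q A :: "real^'n^'n" and B :: "real^'m^'n"
    and lo hi :: "real^'m" and U :: "(real^'m) set" and x0 :: "real^'n"
  assumes "transpose J = - J"
    and "transpose R = R" and "pos_semidef R"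
    and "transpose Q = Q" and "pos_def Q"
    and "CARD('m) \<le> CARD('n)" and "rank B = CARD('m)"
    and "A = (J - R) ** Q"
    and "U = cbox lo hi" and "0 \<in> interior U"
    and "rank (kalman_matrix A B) = CARD('n)"
  shows "\<exists>K. compact K \<and> K \<subseteq> dissipative_subspace Q A \<and>
           reachable_set A B U x0 \<subseteq> {v + k | v k. v \<in> conservative_subspace A \<and> k \<in> K}"
proof -
  note J = assms(1) and R = assms(2,3) and Q = assms(4,5) and A = assms(8)
  define q where "q x y = (Q *v x) \<bullet> y" for x y
  let ?M1 = "conservative_subspace A" and ?M2 = "dissipative_subspace Q A"
  have q: "bounded_bilinear q"
    unfolding bilinear_conv_bounded_bilinear[symmetric] bilinear_def q_def
    by (intro conjI allI linearI)
       (auto simp: matrix_vector_right_distrib matrix_vector_mult_scaleR inner_add_left inner_add_right)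
  interpret q: bounded_bilinear q by fact
  have sym: "q x y = q y x" for x y
    using matrix_vector_inner_transpose[of Q x y] Q(1) by (simp add: q_def inner_commute)
  have pos: "0 < q x x" if "x \<noteq> 0" for x using Q(2) that by (simp add: q_def pos_def_def)
  have linA: "linear ((*v) A)" by simp
  have Av: "A *v x = J *v (Q *v x) - R *v (Q *v x)" for x
    by (simp add: A matrix_vector_mul_assoc[symmetric] matrix_vector_mult_diff_rdistrib)
  have Jskew: "(J *v x) \<bullet> y = - (x \<bullet> (J *v y))" for x y
  proof -
    have "transpose J *v y = - (J *v y)"
      using matrix_vector_mult_diff_rdistrib[of 0 J y] by (simp add: J)
    then show ?thesis using matrix_vector_inner_transpose[of J x y] by simp
  qed
  have Rsym: "(R *v x) \<bullet> y = x \<bullet> (R *v y)" for x y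
    using matrix_vector_inner_transpose[of R x y] R by simp
  have qA: "q (A *v x) y = (A *v x) \<bullet> (Q *v y)" for x y
    using sym[of "A *v x" y] by (simp add: q_def inner_commute)
  have qAx: "q (A *v x) x = - ((R *v (Q *v x)) \<bullet> (Q *v x))" for x
    \<comment> \<open>Energy balance: the skew part \<open>J\<close> does no work.\<close>
    using Jskew[of "Q *v x" "Q *v x"] unfolding qA by (simp add: Av inner_diff_left inner_diff_right inner_commute)
  have diss: "q (A *v x) x \<le> 0" for x
    using R(2) by (simp add: qAx pos_semidef_def)
  have RQ0: "R *v (Q *v x) = 0" if "q (A *v x) x = 0" for x
    using pos_semidef_inner_eq_0[OF R] that by (simp add: qAx)
  \<comment> \<open>Both properties of the conservative subspace, vanishing of \<open>R Q\<close>
    and invariance under \<open>A\<close>, are put into one subspace so that minimality gives them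
    together.\<close>
  have M1: "?M1 \<subseteq> {y. R *v (Q *v y) = 0 \<and> A *v y \<in> ?M1}"
  proof (rule conservative_subspace_minimal)
    show "subspace {y. R *v (Q *v y) = 0 \<and> A *v y \<in> ?M1}"
      using subspace_conservative_subspace[of A]
      by (auto simp: subspace_def matrix_vector_right_distrib matrix_vector_mult_scaleR)
  next
    fix \<alpha> z
    assume z: "z \<in> matrix_kernel (map_matrix complex_of_real A - mat (\<i> * complex_of_real \<alpha>))"
    let ?a = "Re_vec z" and ?b = "Im_vec z"
    have ab: "A *v ?a = - \<alpha> *\<^sub>R ?b" "A *v ?b = \<alpha> *\<^sub>R ?a"
      using z unfolding matrix_kernel_imaginary_iff by auto
    \<comment> \<open>The two terms are opposite multiples of \<open>q ?a ?b\<close>; being both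
      nonpositive, each must vanish.\<close>
    have "q (A *v ?a) ?a + q (A *v ?b) ?b = 0"
      unfolding ab using sym[of ?a ?b] by (simp add: q.scaleR_left q.minus_left)
    then have "q (A *v ?a) ?a = 0" "q (A *v ?b) ?b = 0"
      using diss[of ?a] diss[of ?b] by auto
    then have "R *v (Q *v ?a) = 0" "R *v (Q *v ?b) = 0" using RQ0 by auto
    moreover have "A *v ?a \<in> ?M1" "A *v ?b \<in> ?M1"
      unfolding ab using eigenvector_parts_in_conservative_subspace[OF z]
      by (auto intro!: subspace_scale[OF subspace_conservative_subspace]
          simp del: scaleR_minus_left)
    ultimately show "?a \<in> {y. R *v (Q *v y) = 0 \<and> A *v y \<in> ?M1} \<and>
        ?b \<in> {y. R *v (Q *v y) = 0 \<and> A *v y \<in> ?M1}" by blast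
  qed
  have M2_iff: "x \<in> ?M2 \<longleftrightarrow> (\<forall>y\<in>?M1. q x y = 0)" for x
    by (simp add: dissipative_subspace_def q_def)
  have M2: "subspace ?M2"
    unfolding subspace_def by (auto simp: M2_iff q.zero_left q.add_left q.scaleR_left)
  have M2_inv: "A *v x \<in> ?M2" if x: "x \<in> ?M2" for x
    unfolding M2_iff
  proof
    fix y assume y: "y \<in> ?M1"
    then have RQy: "R *v (Q *v y) = 0" and Ay: "A *v y \<in> ?M1" using M1 by auto
    \<comment> \<open>Against \<open>y\<close> the resistive part drops out by symmetry of
      \<open>R\<close>, which leaves the skew part, and \<open>A *v y\<close> is
      \<open>J *v (Q *v y)\<close>.\<close>
    have "q (A *v x) y = - q x (A *v y)"
      unfolding qA by (simp add: Av inner_diff_left Jskew Rsym RQy q_def)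
    then show "q (A *v x) y = 0" using x Ay by (simp add: M2_iff)
  qed
  have triv: "N \<subseteq> {0}"
    if N: "subspace N" "N \<subseteq> ?M2" "\<And>x. x \<in> N \<Longrightarrow> A *v x \<in> N" "\<And>x. x \<in> N \<Longrightarrow> q (A *v x) x = 0" for N
  proof (rule ccontr)
    assume "\<not> N \<subseteq> {0}"
    then obtain v \<alpha> where v: "v \<in> N" "v \<noteq> 0" "A *v (A *v v) = - (\<alpha>\<^sup>2) *\<^sub>R v"
      using skew_on_subspace_eigenvector[OF linA q sym pos N(1,3,4)] by metis
    \<comment> \<open>Losslessness at \<open>v + A *v v\<close> rules out a Jordan block at zero:
      with \<open>A *v (A *v v) = 0\<close> the form reduces to
      \<open>q (A *v v) (A *v v)\<close>.\<close>
    have "A *v v = 0" if "\<alpha> = 0"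
    proof (rule ccontr)
      assume ne: "A *v v \<noteq> 0"
      have "q (A *v (v + A *v v)) (v + A *v v) = 0"
        using v(1) N by (simp add: subspace_add)
      then have "q (A *v v) (A *v v) = 0"
        using v N(4)[OF v(1)] that by (simp add: matrix_vector_right_distrib q.add_right)
      then show False using pos[OF ne] by simp
    qed
    then have "v \<in> ?M1" using v(3) by (rule skew_eigenvector_in_conservative_subspace[rotated])
    then have "q v v = 0" using v(1) N(2) M2_iff by blast
    then show False using pos[OF v(2)] by simp
  qed
  have "\<exists>w c. bounded_bilinear w \<and> (\<forall>x y. w x y = w y x) \<and> c > 0 \<and>
      (\<forall>x\<in>?M2. c * (norm x)\<^sup>2 \<le> w x x \<and> w (A *v x) x \<le> - c * (norm x)\<^sup>2)"
    by (rule strict_lyapunov_form[OF linA q sym pos diss M2 triv M2_inv])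
  then obtain w c where w: "bounded_bilinear w" "\<And>x y. w x y = w y x" and "c > 0"
    and low: "\<And>x. x \<in> ?M2 \<Longrightarrow> c * (norm x)\<^sup>2 \<le> w x x"
    and dec: "\<And>x. x \<in> ?M2 \<Longrightarrow> w (A *v x) x \<le> - c * (norm x)\<^sup>2"
    by blast
  have "\<exists>P. linear P \<and> (\<forall>x. \<forall>y\<in>?M1. q (P x) y = 0) \<and> (\<forall>x. x - P x \<in> ?M1) \<and>
      (\<forall>x\<in>?M1. P x = 0) \<and> (\<forall>x. (\<forall>y\<in>?M1. q x y = 0) \<longrightarrow> P x = x)"
    by (rule bounded_bilinear_orthogonal_projection[OF q sym pos subspace_conservative_subspace])
  then obtain P where P: "linear P" and P_orth: "\<And>x y. y \<in> ?M1 \<Longrightarrow> q (P x) y = 0"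
    and P_diff: "\<And>x. x - P x \<in> ?M1" and P_M1: "\<And>x. x \<in> ?M1 \<Longrightarrow> P x = 0"
    and P_M2: "\<And>x. \<forall>y\<in>?M1. q x y = 0 \<Longrightarrow> P x = x"
    by blast
  have P_in: "P x \<in> ?M2" for x using P_orth by (simp add: M2_iff)
  have PA: "P (A *v x) = A *v P x" for x
  proof -
    \<comment> \<open>Both subspaces are invariant under \<open>A\<close>; \<open>P\<close> fixes
      the first summand and annihilates the second.\<close>
    have "A *v x = A *v P x + A *v (x - P x)" by (simp add: matrix_vector_mult_diff_distrib)
    moreover have "P (A *v (x - P x)) = 0" using M1 P_diff by (intro P_M1) blast
    moreover have "P (A *v P x) = A *v P x" using M2_inv[OF P_in[of x]] by (intro P_M2) (simp add: M2_iff)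
    ultimately show ?thesis using linear_add[OF P] by (metis add.right_neutral)
  qed
  have "bounded U" using assms(9) by simp
  then obtain \<rho> where \<rho>: "\<And>y. y \<in> reachable_set A B U x0 \<Longrightarrow> norm (P y) \<le> \<rho>"
    using bounded_input_bounded_state[OF _ P PA w \<open>c > 0\<close> low[OF P_in] dec[OF P_in]] by blast
  \<comment> \<open>The radius \<open>\<rho>\<close> is uniform over all times and controls, so one
    ball serves every reachable state.\<close>
  let ?K = "?M2 \<inter> cball 0 \<rho>"
  have "compact ?K" using closed_subspace[OF M2] by (simp add: closed_Int_compact)
  moreover have "reachable_set A B U x0 \<subseteq> {v + k | v k. v \<in> ?M1 \<and> k \<in> ?K}"
  proof
    fix y assume "y \<in> reachable_set A B U x0"
    then have "P y \<in> ?K" using \<rho> P_in by simp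
    moreover have "y = (y - P y) + P y" by simp
    ultimately show "y \<in> {v + k | v k. v \<in> ?M1 \<and> k \<in> ?K}" using P_diff by blast
  qed
  ultimately show ?thesis by blast
qed

end
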